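(* For every $n\ge 1$, the number of self-complementary noncrossing partitions of $[n]$ is $\binom{n}{\lfloor n/2\rfloor}$.
   Context: Write $[n]=\{1,2,\dots,n\}$. A partition of $[n]$ is noncrossing if no quadruple $a<b<c<d$ has $a,c$ in one block and $b,d$ in a different block. The complement $C(\pi)$ of a partition $\pi$ of $[n]$ is the partition obtained by replacing every element $i$ by $n+1-i$. A partition $\pi$ is self-complementary if $C(\pi)=\pi$. *)

theory Defs
  imports Main "HOL-Library.Disjoint_Sets"
begin

definition noncrossing :: "nat set set \<Rightarrow> bool" where
  "noncrossing P \<longleftrightarrow>
     \<not> (\<exists>a b c d. a < b \<and> b < c \<and> c < d \<and>
          (\<exists>A\<in>P. \<exists>B\<in>P. A \<noteq> B \<and> a \<in> A \<and> c \<in> A \<and> b \<in> B \<and> d \<in> B))"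

(* The subtraction on nat does not truncate when the elements of the blocks lie in {1..n}. *)
definition complement :: "nat \<Rightarrow> nat set set \<Rightarrow> nat set set" where
  "complement n P = (\<lambda>B. (\<lambda>i. n + 1 - i) ` B) ` P"

definition self_complementary :: "nat \<Rightarrow> nat set set \<Rightarrow> bool" where
  "self_complementary n P \<longleftrightarrow> complement n P = P"

end

theory Submission
  imports Defs
begin

text \<open>A noncrossing partition of a finite set of naturals is determined by the set \<open>M\<close> of its block
  minima and the set \<open>X\<close> of its block maxima, and a pair \<open>(M, X)\<close> of equal cardinality arises iff
  at every element \<open>i\<close> more blocks have been opened up to \<open>i\<close> than closed before \<open>i\<close>: both
  existence and uniqueness follow by splitting off the block that closes first.
  Complementation exchanges minima and maxima, so a noncrossing partition is self-complementary iff
  \<open>X\<close> is the reflection of \<open>M\<close>. Then \<open>M\<close> alone encodes the partition, and the condition on \<open>M\<close>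
  is a ballot condition. The number of such \<open>M\<close> satisfies a recursion, obtained by removing the two
  end points of the interval, which is solved by sums of binomial coefficients around the middle.\<close>

section \<open>Noncrossing partitions and the block closed first\<close>

lemma noncrossingD:
  assumes "noncrossing P" "A \<in> P" "B \<in> P" "a < b" "b < c" "c < d"
    "a \<in> A" "c \<in> A" "b \<in> B" "d \<in> B"
  shows "A = B"
  using assms unfolding noncrossing_def by blast

lemma noncrossing_subset: "noncrossing P \<Longrightarrow> Q \<subseteq> P \<Longrightarrow> noncrossing Q"
  unfolding noncrossing_def by blast

text \<open>Each crossing puts a point of either block between two points of the other. A point of
  \<open>A\<close> between two points of the interval block lies in that block, so no other block
  can cross it.\<close>

lemma noncrossing_insert_interval:
  fixes A :: "nat set"
  assumes "partition_on (A - A \<inter> {m..x}) Q" "noncrossing Q"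
  shows "noncrossing (insert (A \<inter> {m..x}) Q)"
proof -
  have Q: "C \<subseteq> A - {m..x}" if "C \<in> Q" for C
    using assms(1) that by (auto simp: partition_on_def)
  have "C = D" if h: "C \<in> insert (A \<inter> {m..x}) Q" "D \<in> insert (A \<inter> {m..x}) Q"
    "a < b" "b < c" "c < d" "a \<in> C" "c \<in> C" "b \<in> D" "d \<in> D" for a b c d C D
  proof -
    consider "C \<in> Q" "D \<in> Q" | "C = A \<inter> {m..x}" "D \<in> Q" | "D = A \<inter> {m..x}" "C \<in> Q"
      | "C = A \<inter> {m..x}" "D = A \<inter> {m..x}"
      using h(1,2) by blast
    then show ?thesis
    proof cases
      case 1
      then show ?thesis using noncrossingD[OF assms(2)] h by blast
    next
      case 2
      then have "b \<in> A - {m..x}" using Q h by blast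
      then show ?thesis using 2 h by auto
    next
      case 3
      then have "c \<in> A - {m..x}" using Q h by blast
      then show ?thesis using 3 h by auto
    qed simp
  qed
  then show ?thesis unfolding noncrossing_def by blast
qed

lemma inj_on_choice_partition:
  assumes "partition_on A P" "\<And>B. B \<in> P \<Longrightarrow> f B \<in> B"
  shows "inj_on f P"
proof (rule inj_onI)
  fix B C assume "B \<in> P" "C \<in> P" "f B = f C"
  then have "f B \<in> B \<inter> C" using assms(2) by (metis IntI)
  then show "B = C"
    using partition_onD2[OF assms(1)] \<open>B \<in> P\<close> \<open>C \<in> P\<close> by (auto dest: disjointD)
qed

lemma partition_on_finite_block:
  fixes A :: "nat set"
  assumes "finite A" "partition_on A P" "B \<in> P"
  shows "finite B" "B \<noteq> {}" "Min B \<in> B" "Max B \<in> B" "B \<subseteq> A"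
proof -
  show "B \<subseteq> A" "B \<noteq> {}" using assms(2,3) by (auto simp: partition_on_def)
  then show "finite B" using assms(1) finite_subset by blast
  then show "Min B \<in> B" "Max B \<in> B" using \<open>B \<noteq> {}\<close> by auto
qed

text \<open>The block closed first has no opening and no closing strictly inside it, so it is an interval
  of the ground set.\<close>

lemma first_closed_block:
  fixes A :: "nat set"
  assumes "finite A" "partition_on A P" "noncrossing P" "P \<noteq> {}"
    and x: "x = Min (Max ` P)" and m: "m = Max (Min ` P \<inter> {..x})"
  shows "A \<inter> {m..x} \<in> P \<and> Min (A \<inter> {m..x}) = m \<and> Max (A \<inter> {m..x}) = x"
proof -
  note blk = partition_on_finite_block[OF assms(1,2)]
  have fP: "finite P" using assms(1,2) by (rule finite_elements)
  have disj: "C = D" if "C \<in> P" "D \<in> P" "z \<in> C" "z \<in> D" for C D z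
    using partition_onD2[OF assms(2)] that by (auto dest: disjointD)
  have "x \<in> Max ` P" using x fP assms(4) by simp
  then obtain B where B: "B \<in> P" "Max B = x" by blast
  have x_le: "x \<le> Max C" if "C \<in> P" for C using x fP that by simp
  have xB: "x \<in> B" using blk(4) B by blast
  have "Min B \<le> x" using blk B by (metis Min_le)
  then have mem: "m \<in> Min ` P \<inter> {..x}" unfolding m using fP B by (intro Max_in) auto
  have le_m: "Min C \<le> m" if "C \<in> P" "Min C \<le> x" for C unfolding m using fP that by simp
  obtain D where D: "D \<in> P" "Min D = m" using mem by blast
  have mx: "m \<le> x" using mem by simp
  have mD: "m \<in> D" using blk(3) D by blast
  \<comment> \<open>\<open>D\<close> opens last among the blocks open by \<open>x\<close>. If it
    differed from \<open>B\<close>, it would open inside \<open>B\<close> and close after it, so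
    \<open>Min B < m < x < Max D\<close> would be a crossing.\<close>
  have "D = B"
  proof (rule ccontr)
    assume "D \<noteq> B"
    then have "Max D \<noteq> x" using disj[OF D(1) B(1) _ xB] blk(4)[OF D(1)] by auto
    moreover have "m \<noteq> x" using disj[OF D(1) B(1) mD] xB \<open>D \<noteq> B\<close> by auto
    moreover have "Min B \<noteq> m" using disj[OF D(1) B(1) mD] blk(3)[OF B(1)] \<open>D \<noteq> B\<close> by auto
    ultimately have "Min B < m" "m < x" "x < Max D"
      using le_m[OF B(1) \<open>Min B \<le> x\<close>] mx x_le[OF D(1)] by auto
    then show False
      using noncrossingD[OF assms(3) B(1) D(1)] blk(3)[OF B(1)] xB mD blk(4)[OF D(1)] \<open>D \<noteq> B\<close>
      by blast
  qed
  have "B = A \<inter> {m..x}"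
  proof
    show "B \<subseteq> A \<inter> {m..x}" using blk[OF B(1)] B(2) D(2) \<open>D = B\<close> by auto
    \<comment> \<open>The block \<open>C\<close> of \<open>y\<close> opens by \<open>x\<close>,
      hence by \<open>m\<close>. If it is not \<open>B\<close>, then
      \<open>Min C < m < y < x\<close> is a crossing.\<close>
    show "A \<inter> {m..x} \<subseteq> B"
    proof
      fix y assume y: "y \<in> A \<inter> {m..x}"
      then obtain C where C: "C \<in> P" "y \<in> C" using partition_onD1[OF assms(2)] by blast
      show "y \<in> B"
      proof (rule ccontr)
        assume "y \<notin> B"
        then have "C \<noteq> B" using C by auto
        have "Min C \<le> y" using blk(1)[OF C(1)] C(2) by simp
        then have "Min C \<le> m" using le_m[OF C(1)] y by auto
        moreover have "Min C \<noteq> m"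
          using disj[OF C(1) B(1) blk(3)[OF C(1)]] mD \<open>D = B\<close> \<open>C \<noteq> B\<close> by auto
        moreover have "m \<noteq> y" "y \<noteq> x" using \<open>y \<notin> B\<close> mD \<open>D = B\<close> xB by auto
        ultimately have "Min C < m" "m < y" "y < x" using y by auto
        then show False
          using noncrossingD[OF assms(3) C(1) B(1)] blk(3)[OF C(1)] C(2) mD \<open>D = B\<close> xB \<open>C \<noteq> B\<close>
          by blast
      qed
    qed
  qed
  then show ?thesis using B D \<open>D = B\<close> by auto
qed

section \<open>Reconstruction from block minima and maxima\<close>

text \<open>The bounds are strict for \<open>X\<close> but not for \<open>M\<close> because a block
  that opens or closes at \<open>i\<close> contains \<open>i\<close>.\<close>

definition admissible :: "nat set \<Rightarrow> nat set \<Rightarrow> nat set \<Rightarrow> bool" where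
  "admissible A M X \<longleftrightarrow> M \<subseteq> A \<and> X \<subseteq> A \<and> card M = card X \<and>
     (\<forall>i\<in>A. card (X \<inter> {..<i}) < card (M \<inter> {..i}))"

text \<open>Every block closed before \<open>i\<close> was opened before \<open>i\<close>; the block
  of \<open>i\<close> itself is opened by \<open>i\<close> but not closed before it, which makes the
  inclusion strict.\<close>

lemma admissible_Min_Max:
  fixes A :: "nat set"
  assumes "finite A" "partition_on A P"
  shows "admissible A (Min ` P) (Max ` P)"
proof -
  note blk = partition_on_finite_block[OF assms]
  have fP: "finite P" using assms by (rule finite_elements)
  have injs: "inj_on Min P" "inj_on Max P"
    using inj_on_choice_partition[OF assms(2)] blk by blast+
  have "card (Max ` P \<inter> {..<i}) < card (Min ` P \<inter> {..i})" if i: "i \<in> A" for i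
  proof -
    obtain B where B: "B \<in> P" "i \<in> B" using partition_onD1[OF assms(2)] i by blast
    have B': "Min B \<le> i" "i \<le> Max B" using blk(1)[OF B(1)] B(2) by auto
    have "Max ` P \<inter> {..<i} = Max ` {C \<in> P. Max C < i}"
      "Min ` P \<inter> {..i} = Min ` {C \<in> P. Min C \<le> i}" by auto
    then have cards: "card (Max ` P \<inter> {..<i}) = card {C \<in> P. Max C < i}"
      "card (Min ` P \<inter> {..i}) = card {C \<in> P. Min C \<le> i}"
      using injs by (auto intro!: card_image elim: inj_on_subset)
    have "Min C \<le> Max C" if "C \<in> P" for C using blk[OF that] by simp
    then have "{C \<in> P. Max C < i} \<subseteq> {C \<in> P. Min C \<le> i}" by force
    moreover have "B \<in> {C \<in> P. Min C \<le> i}" "B \<notin> {C \<in> P. Max C < i}" using B B' by auto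
    ultimately have "{C \<in> P. Max C < i} \<subset> {C \<in> P. Min C \<le> i}" by blast
    then show ?thesis unfolding cards using fP by (intro psubset_card_mono) auto
  qed
  moreover have "card (Min ` P) = card (Max ` P)" using injs by (simp add: card_image)
  ultimately show ?thesis unfolding admissible_def using blk by blast
qed

text \<open>The block that closes at the least element \<open>x\<close> of \<open>X\<close> is
  forced: it opens at the last opening \<open>m\<close> up to \<open>x\<close> and takes all of
  \<open>A\<close> in between. Removing it leaves a smaller admissible pair.\<close>

lemma ex1_noncrossing:
  fixes A :: "nat set"
  assumes "finite A" "admissible A M X"
  shows "\<exists>!P. partition_on A P \<and> noncrossing P \<and> Min ` P = M \<and> Max ` P = X"
  using assms
proof (induction "card A" arbitrary: A M X rule: less_induct)
  case less
  show ?case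
  proof (cases "M = {}")
    case True
    then have "X = {}" using less.prems unfolding admissible_def
      by (metis card_eq_0_iff finite_subset)
    \<comment> \<open>An element of \<open>A\<close> would require an opening at or before
      it.\<close>
    have "A = {}" using less.prems True unfolding admissible_def by auto
    show ?thesis
      by (rule ex1I[of _ "{}"]) (use True \<open>X = {}\<close> \<open>A = {}\<close> in
        \<open>auto simp: noncrossing_def partition_on_def\<close>)
  next
    case False
    have MX: "M \<subseteq> A" "X \<subseteq> A" "card M = card X"
      and bal: "\<And>i. i \<in> A \<Longrightarrow> card (X \<inter> {..<i}) < card (M \<inter> {..i})"
      using less.prems(2) unfolding admissible_def by auto
    have fin: "finite M" "finite X" using MX less.prems(1) finite_subset by auto
    have "X \<noteq> {}" using MX False fin by (metis card_eq_0_iff)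
    define x where "x = Min X"
    define m where "m = Max (M \<inter> {..x})"
    define B where "B = A \<inter> {m..x}"
    have xX: "x \<in> X" and x_le: "\<And>y. y \<in> X \<Longrightarrow> x \<le> y"
      using fin \<open>X \<noteq> {}\<close> by (auto simp: x_def)
    have "x \<in> A" using xX MX by blast
    have "M \<inter> {..x} \<noteq> {}" using bal[OF \<open>x \<in> A\<close>] by auto
    then have "m \<in> M \<inter> {..x}" unfolding m_def using fin by (intro Max_in) auto
    then have mM: "m \<in> M" and mx: "m \<le> x" by auto
    have le_m: "y \<le> m" if "y \<in> M" "y \<le> x" for y unfolding m_def using fin that by simp
    have "m \<in> A" using mM MX by blast
    \<comment> \<open>No opening lies in \<open>A\<close> after \<open>m\<close> and up to
      \<open>x\<close>, and no closing lies before \<open>x\<close>.\<close>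
    have MB: "M \<inter> B = {m}" using mM mx le_m \<open>m \<in> A\<close> unfolding B_def by fastforce
    have XB: "X \<inter> B = {x}" using xX mx x_le \<open>x \<in> A\<close> unfolding B_def by fastforce
    have "m \<in> B" "x \<in> B" using MB XB by auto
    have MinB: "Min B = m" and MaxB: "Max B = x"
      using \<open>m \<in> B\<close> \<open>x \<in> B\<close> by (auto simp: B_def less.prems(1) intro!: Min_eqI Max_eqI)
    have "card (A - B) < card A"
      using less.prems(1) \<open>m \<in> B\<close> \<open>m \<in> A\<close> by (intro psubset_card_mono) auto
    moreover have "admissible (A - B) (M - {m}) (X - {x})"
      unfolding admissible_def
    proof (intro conjI ballI)
      show "M - {m} \<subseteq> A - B" "X - {x} \<subseteq> A - B" using MB XB MX by auto
      show "card (M - {m}) = card (X - {x})" using MX mM xX fin by simp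
      fix i assume i: "i \<in> A - B"
      \<comment> \<open>Left of \<open>m\<close> the openings are unchanged; right of
        \<open>x\<close> both counts drop by one.\<close>
      then have "i < m \<or> x < i" by (auto simp: B_def)
      then show "card ((X - {x}) \<inter> {..<i}) < card ((M - {m}) \<inter> {..i})"
      proof
        assume "i < m"
        then have "(M - {m}) \<inter> {..i} = M \<inter> {..i}" by auto
        moreover have "card ((X - {x}) \<inter> {..<i}) \<le> card (X \<inter> {..<i})"
          using fin by (intro card_mono) auto
        ultimately show ?thesis using bal[of i] i by simp
      next
        assume "x < i"
        then have "(M - {m}) \<inter> {..i} = (M \<inter> {..i}) - {m}" "m \<in> M \<inter> {..i}"
          "(X - {x}) \<inter> {..<i} = (X \<inter> {..<i}) - {x}" "x \<in> X \<inter> {..<i}"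
          using mM xX mx by auto
        \<comment> \<open>Positivity keeps the subtraction of one from truncating at 0.\<close>
        moreover have "card (X \<inter> {..<i}) > 0"
          using \<open>x \<in> X \<inter> {..<i}\<close> fin by (auto simp: card_gt_0_iff)
        ultimately show ?thesis using bal[of i] i fin by simp
      qed
    qed
    ultimately obtain Q where Q: "partition_on (A - B) Q" "noncrossing Q"
        "Min ` Q = M - {m}" "Max ` Q = X - {x}"
      and uniq: "\<And>Q'. partition_on (A - B) Q' \<Longrightarrow> noncrossing Q' \<Longrightarrow>
        Min ` Q' = M - {m} \<Longrightarrow> Max ` Q' = X - {x} \<Longrightarrow> Q' = Q"
      using less.hyps[of "A - B" "M - {m}" "X - {x}"] less.prems(1)
      by (metis finite_Diff)
    show ?thesis
    proof (rule ex1I[of _ "insert B Q"], intro conjI)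
      have "disjnt B (\<Union>Q)" using partition_onD1[OF Q(1)] by (auto simp: disjnt_iff)
      then show "partition_on A (insert B Q)"
        using Q(1) \<open>m \<in> B\<close> by (auto simp: partition_on_insert B_def)
      show "noncrossing (insert B Q)"
        using noncrossing_insert_interval Q(1,2) unfolding B_def by blast
      show "Min ` insert B Q = M" "Max ` insert B Q = X"
        using Q(3,4) MinB MaxB mM xX by auto
    next
      fix P assume P: "partition_on A P \<and> noncrossing P \<and> Min ` P = M \<and> Max ` P = X"
      then have "P \<noteq> {}" using False by auto
      \<comment> \<open>The choices of \<open>x\<close> and \<open>m\<close> depend only on
        \<open>X\<close> and \<open>M\<close>, so every competitor \<open>P\<close> contains the
        same block \<open>B\<close>, and uniqueness passes to \<open>P - {B}\<close>.\<close>
      then have BP: "B \<in> P"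
        using first_closed_block[of A P x m] P less.prems(1) by (simp add: x_def m_def B_def)
      note injs = inj_on_choice_partition[of A P Min] inj_on_choice_partition[of A P Max]
      have "inj_on Min P" "inj_on Max P"
        using injs P partition_on_finite_block[OF less.prems(1), of P] by blast+
      then have "Min ` (P - {B}) = M - {m}" "Max ` (P - {B}) = X - {x}"
        using BP P MinB MaxB by (auto simp: inj_on_image_set_diff[where C=P])
      moreover have "noncrossing (P - {B})" using P noncrossing_subset by blast
      moreover have "disjnt B (\<Union>(P - {B}))"
        using P BP by (auto simp: partition_on_def disjnt_def dest: disjointD)
      then have "partition_on (A - B) (P - {B})"
        using P BP partition_on_insert[of B "P - {B}" A] by (simp add: insert_absorb)
      ultimately have "P - {B} = Q" by (intro uniq)
      then show "P = insert B Q" using BP by blast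
    qed
  qed
qed

lemma noncrossing_eqI:
  fixes A :: "nat set"
  assumes "finite A" "partition_on A P" "noncrossing P" "partition_on A Q" "noncrossing Q"
    "Min ` P = Min ` Q" "Max ` P = Max ` Q"
  shows "P = Q"
  using ex1_noncrossing[OF assms(1) admissible_Min_Max[OF assms(1,2)]] assms(2-7) by auto

section \<open>Ballot sets and their recursion\<close>

text \<open>Splits by membership of \<open>x\<close>. As \<open>Q\<close> is arbitrary, it can be
  applied once for each end point of an interval.\<close>

lemma card_subsets_insert:
  assumes "finite I" "x \<notin> I"
  shows "card {M. M \<subseteq> insert x I \<and> Q M}
    = card {M. M \<subseteq> I \<and> Q M} + card {M. M \<subseteq> I \<and> Q (insert x M)}"
proof -
  have "{M. M \<subseteq> insert x I \<and> Q M}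
      = {M. M \<subseteq> I \<and> Q M} \<union> insert x ` {M. M \<subseteq> I \<and> Q (insert x M)}" (is "?S = ?T \<union> _ ` ?U")
  proof (intro set_eqI iffI)
    fix M assume M: "M \<in> ?S"
    show "M \<in> ?T \<union> insert x ` ?U"
    proof (cases "x \<in> M")
      case True
      then have "M = insert x (M - {x})" "M - {x} \<in> ?U" using M by (auto simp: insert_absorb)
      then show ?thesis by blast
    qed (use M in auto)
  qed auto
  moreover have "?T \<inter> insert x ` ?U = {}" using assms by auto
  moreover have "inj_on (insert x) ?U"
    by (rule inj_onI) (use assms in \<open>auto simp: insert_ident subset_iff\<close>)
  moreover have "finite ?T" "finite ?U" using assms(1) by auto
  ultimately show ?thesis by (simp add: card_Un_disjoint card_image)
qed

text \<open>Reading the interval \<open>{l..<l + n}\<close> from its two ends inwards turns these sets into lattice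
  paths with \<open>n\<close> steps that start at height \<open>2 * h\<close> and never become negative: elements of the
  set on the left and non-elements on the right are up-steps.\<close>

definition ballot_sets :: "nat \<Rightarrow> nat \<Rightarrow> nat \<Rightarrow> nat set set" where
  "ballot_sets l n h = {M. M \<subseteq> {l..<l + n} \<and>
     (\<forall>i<n. card (M \<inter> {l + n - i..<l + n}) < h + card (M \<inter> {l..l + i}))}"

text \<open>\<open>P\<close> and \<open>R\<close> record whether the two end points belong to the
  set, so all four cases are treated at once. The instance \<open>i = 0\<close> sees only
  \<open>P\<close>; an instance \<open>Suc i\<close> with \<open>i < n\<close> is the inner instance
  \<open>i\<close> with both counts enlarged by the end points.\<close>

lemma ballot_condition_extend:
  assumes "M \<subseteq> {Suc l..<Suc l + n}" "P \<subseteq> {l}" "R \<subseteq> {Suc l + n}"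
  shows "(\<forall>i<Suc (Suc n). card ((M \<union> P \<union> R) \<inter> {l + Suc (Suc n) - i..<l + Suc (Suc n)})
            < h + card ((M \<union> P \<union> R) \<inter> {l..l + i}))
    \<longleftrightarrow> 0 < h + card P \<and> (\<forall>i<n. card R + card (M \<inter> {Suc l + n - i..<Suc l + n})
            < h + card P + card (M \<inter> {Suc l..Suc l + i}))"
proof -
  have fin: "finite M" "finite P" "finite R" using assms finite_subset by blast+
  have un: "card (B \<union> P) = card B + card P" "card (B \<union> R) = card B + card R"
    "card (B \<union> P \<union> R) = card B + card P + card R" if "B \<subseteq> M" for B
  proof -
    have "B \<inter> P = {}" "B \<inter> R = {}" "P \<inter> R = {}" using assms that by fastforce+
    then show "card (B \<union> P) = card B + card P" "card (B \<union> R) = card B + card R"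
      "card (B \<union> P \<union> R) = card B + card P + card R"
      using fin finite_subset[OF that fin(1)] by (auto simp: card_Un_disjoint Int_Un_distrib2)
  qed
  have first: "(M \<union> P \<union> R) \<inter> {l..l + 0} = P" using assms by auto
  have right: "(M \<union> P \<union> R) \<inter> {l + Suc (Suc n) - Suc i..<l + Suc (Suc n)}
      = (M \<inter> {Suc l + n - i..<Suc l + n}) \<union> R" if "i < Suc n" for i
    using assms that by fastforce
  have left: "(M \<union> P \<union> R) \<inter> {l..l + Suc i} = (M \<inter> {Suc l..Suc l + i}) \<union> P" if "i < n" for i
    using assms that by fastforce
  \<comment> \<open>At \<open>i = Suc n\<close> the left count covers the whole set and the right
    count all but \<open>P\<close>, so this instance repeats the condition from
    \<open>i = 0\<close>.\<close>
  have last: "(M \<union> P \<union> R) \<inter> {l..l + Suc n} = M \<union> P \<union> R" using assms by fastforce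
  have "M \<inter> {Suc l..<Suc l + n} = M" using assms(1) by blast
  then have "card ((M \<union> P \<union> R) \<inter> {l + Suc (Suc n) - Suc n..<l + Suc (Suc n)}) = card M + card R"
    using right[of n] un by simp
  moreover have "card ((M \<union> P \<union> R) \<inter> {l + Suc (Suc n) - Suc i..<l + Suc (Suc n)})
      = card R + card (M \<inter> {Suc l + n - i..<Suc l + n})" if "i < n" for i
    using right[of i] un[of "M \<inter> {Suc l + n - i..<Suc l + n}"] that by simp
  moreover have "card ((M \<union> P \<union> R) \<inter> {l..l + Suc i}) = card P + card (M \<inter> {Suc l..Suc l + i})"
    if "i < n" for i
    using left[OF that] un[of "M \<inter> {Suc l..Suc l + i}"] by simp
  moreover have "card ((M \<union> P \<union> R) \<inter> {l..l + Suc n}) = card M + card P + card R"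
    using last un by simp
  ultimately show ?thesis
    unfolding All_less_Suc2[of "Suc n"] All_less_Suc[of n] first
    by (auto simp: add_ac)
qed

text \<open>Containing only the left end point raises \<open>h\<close>, only the right one lowers
  it, and both or neither keep it. For \<open>h = 0\<close> the left end point is forced.\<close>

lemma card_ballot_sets_rec:
  "card (ballot_sets l (Suc (Suc n)) h) =
     (if h = 0 then card (ballot_sets (Suc l) n 1) + card (ballot_sets (Suc l) n 0)
      else card (ballot_sets (Suc l) n (h + 1)) + 2 * card (ballot_sets (Suc l) n h)
        + card (ballot_sets (Suc l) n (h - 1)))"
proof -
  let ?I = "{Suc l..<Suc l + n}"
  let ?r = "Suc l + n"
  define Q where "Q M \<longleftrightarrow> (\<forall>i<Suc (Suc n). card (M \<inter> {l + Suc (Suc n) - i..<l + Suc (Suc n)})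
     < h + card (M \<inter> {l..l + i}))" for M
  have "{l..<l + Suc (Suc n)} = insert l (insert ?r ?I)" by auto
  then have "ballot_sets l (Suc (Suc n)) h = {M. M \<subseteq> insert l (insert ?r ?I) \<and> Q M}"
    unfolding ballot_sets_def Q_def by simp
  then have split: "card (ballot_sets l (Suc (Suc n)) h) =
      card {M. M \<subseteq> ?I \<and> Q M} + card {M. M \<subseteq> ?I \<and> Q (insert ?r M)}
      + (card {M. M \<subseteq> ?I \<and> Q (insert l M)} + card {M. M \<subseteq> ?I \<and> Q (insert l (insert ?r M))})"
    by (simp add: card_subsets_insert)
  have ext: "Q (M \<union> P \<union> R) \<longleftrightarrow> 0 < h + card P \<and>
      (\<forall>i<n. card R + card (M \<inter> {Suc l + n - i..<Suc l + n})
            < h + card P + card (M \<inter> {Suc l..Suc l + i}))"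
    if "M \<subseteq> ?I" "P \<subseteq> {l}" "R \<subseteq> {?r}" for M P R
    unfolding Q_def using ballot_condition_extend[OF that] .
  have "{M. M \<subseteq> ?I \<and> Q M} = (if h = 0 then {} else ballot_sets (Suc l) n h)"
    using ext[of _ "{}" "{}"] by (auto simp: ballot_sets_def)
  moreover have "{M. M \<subseteq> ?I \<and> Q (insert l M)} = ballot_sets (Suc l) n (h + 1)"
    using ext[of _ "{l}" "{}"] by (auto simp: ballot_sets_def)
  \<comment> \<open>The right end point adds 1 to the smaller side, which amounts to lowering
    \<open>h\<close>; for \<open>h = 0\<close> already the instance \<open>i = 0\<close>
    fails.\<close>
  moreover have "{M. M \<subseteq> ?I \<and> Q (insert ?r M)} = (if h = 0 then {} else ballot_sets (Suc l) n (h - 1))"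
  proof (cases h)
    case 0
    then show ?thesis using ext[of _ "{}" "{?r}"] by auto
  next
    case (Suc k)
    then show ?thesis using ext[of _ "{}" "{?r}"] by (auto simp: ballot_sets_def)
  qed
  moreover have "{M. M \<subseteq> ?I \<and> Q (insert l (insert ?r M))} = ballot_sets (Suc l) n h"
    using ext[of _ "{l}" "{?r}"] by (auto simp: ballot_sets_def insert_commute)
  ultimately show ?thesis unfolding split by simp
qed

section \<open>Sums of binomial coefficients around the middle\<close>

text \<open>This is the sum of \<open>n choose k\<close> over \<open>n div 2 - h \<le> k \<le> n div 2 + h\<close>; the lower half is
  reflected so that no index is truncated at 0.\<close>

definition central_sum :: "nat \<Rightarrow> nat \<Rightarrow> nat" where
  "central_sum n h = (n choose (n div 2)) +
     (\<Sum>d<h. (n choose (n div 2 + Suc d)) + (n choose (Suc n div 2 + Suc d)))"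

text \<open>Pascal's rule applied twice; the lower neighbour of the middle coefficient is reflected
  to the upper half, as in \<open>central_sum\<close>.\<close>

lemma central_binomial_Suc_Suc:
  "(Suc (Suc n) choose Suc (n div 2)) =
     (n choose Suc (n div 2)) + 2 * (n choose (n div 2)) + (n choose Suc (Suc n div 2))"
proof (cases "n div 2")
  case 0
  then have "n = 0 \<or> n = 1" by auto
  then show ?thesis by auto
next
  case (Suc k)
  have "Suc (Suc n div 2) \<le> n" "n - Suc (Suc n div 2) = k" using Suc by linarith+
  then have "(n choose Suc (Suc n div 2)) = (n choose k)"
    using binomial_symmetric[of "Suc (Suc n div 2)" n] by simp
  then show ?thesis using Suc by simp
qed

text \<open>The recursion of \<open>card_ballot_sets_rec\<close>. Raising \<open>h\<close> adds two
  outer coefficients to each sum, and these match by the double Pascal rule.\<close>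

lemma central_sum_rec:
  "central_sum (Suc (Suc n)) 0 = central_sum n 1 + central_sum n 0"
  "central_sum (Suc (Suc n)) (Suc h) =
     central_sum n (Suc (Suc h)) + 2 * central_sum n (Suc h) + central_sum n h"
proof -
  have sym: "(n choose (Suc n div 2)) = (n choose (n div 2))"
  proof -
    have "n - Suc n div 2 = n div 2" "Suc n div 2 \<le> n" by linarith+
    then show ?thesis using binomial_symmetric[of "Suc n div 2" n] by simp
  qed
  show zero: "central_sum (Suc (Suc n)) 0 = central_sum n 1 + central_sum n 0"
    unfolding central_sum_def using central_binomial_Suc_Suc[of n] by simp
  have step: "central_sum m (Suc k) =
      central_sum m k + (m choose (m div 2 + Suc k)) + (m choose (Suc m div 2 + Suc k))" for m k
    by (simp add: central_sum_def)
  have pascal: "(Suc (Suc n) choose (Suc a + Suc k)) =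
      (n choose (a + Suc (Suc k))) + 2 * (n choose (a + Suc k)) + (n choose (a + k))" for a k
    by simp
  have div: "Suc (Suc m) div 2 = Suc (m div 2)" for m by simp
  show "central_sum (Suc (Suc n)) (Suc h) =
     central_sum n (Suc (Suc h)) + 2 * central_sum n (Suc h) + central_sum n h"
  proof (induction h)
    case 0
    \<comment> \<open>The double Pascal rule also yields \<open>n choose (Suc n div 2)\<close>,
      which \<open>sym\<close> identifies with the central coefficient.\<close>
    show ?case using zero sym by (simp add: central_sum_def)
  next
    case (Suc h)
    show ?case
      using Suc step[of n h] step[of n "Suc h"] step[of n "Suc (Suc h)"]
        step[of "Suc (Suc n)" "Suc h", unfolded div pascal]
      by linarith
  qed
qed

text \<open>Induction in steps of two; \<open>l\<close> and \<open>h\<close> vary because the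
  recursion moves both.\<close>

lemma card_ballot_sets: "card (ballot_sets l n h) = central_sum n h"
proof (induction n arbitrary: l h rule: induct_nat_012)
  case 0
  have "ballot_sets l 0 h = {{}}" by (auto simp: ballot_sets_def)
  then show ?case by (simp add: central_sum_def)
next
  case 1
  have "ballot_sets l 1 h = (if h = 0 then {{l}} else {{}, {l}})"
    by (auto simp: ballot_sets_def subset_singleton_iff)
  \<comment> \<open>Only \<open>1 choose 1\<close>, at \<open>d = 0\<close>, is nonzero.\<close>
  moreover have "(\<Sum>d<k. (1 choose (1 div 2 + Suc d)) + (1 choose (Suc 1 div 2 + Suc d)))
      = (if k = 0 then 0 else 1)" for k :: nat
    by (induction k) auto
  ultimately show ?case by (simp add: central_sum_def)
next
  case (ge2 n)
  then show ?case
    unfolding card_ballot_sets_rec by (cases h) (simp_all add: central_sum_rec)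
qed

section \<open>Reflection and self-complementary partitions\<close>

definition reflect :: "nat \<Rightarrow> nat \<Rightarrow> nat" where
  "reflect n i = n + 1 - i"

lemma complement_eq_reflect: "complement n P = (`) (reflect n) ` P"
  by (simp add: complement_def reflect_def)

lemma reflect_reflect: "i \<in> {1..n} \<Longrightarrow> reflect n (reflect n i) = i"
  by (auto simp: reflect_def)

lemma reflect_image_mem:
  "C \<subseteq> {1..n} \<Longrightarrow> i \<in> reflect n ` C \<Longrightarrow> reflect n i \<in> C \<and> i \<le> n"
  by (auto simp: reflect_def subset_iff)

lemma reflect_image_image: "C \<subseteq> {1..n} \<Longrightarrow> reflect n ` reflect n ` C = C"
  using image_cong[of C C "\<lambda>i. reflect n (reflect n i)" "\<lambda>i. i"] reflect_reflect
  by (simp add: image_image subset_iff)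

lemma bij_betw_reflect: "bij_betw (reflect n) {1..n} {1..n}"
  by (rule bij_betwI[where g = "reflect n"]) (auto simp: reflect_def)

lemma partition_on_complement:
  assumes "partition_on {1..n} P"
  shows "partition_on {1..n} (complement n P)"
proof -
  have "{} \<notin> complement n P"
    using partition_onD3[OF assms] by (auto simp: complement_eq_reflect)
  then show ?thesis
    using partition_on_inj_image[OF assms, of "reflect n"] bij_betw_reflect[of n]
    unfolding bij_betw_def complement_eq_reflect by simp
qed

text \<open>Reflection reverses the order, so a crossing reflects to a crossing with the two blocks
  in exchanged roles.\<close>

lemma noncrossing_complement:
  assumes "partition_on {1..n} P" "noncrossing P"
  shows "noncrossing (complement n P)"
  unfolding noncrossing_def
proof (rule notI, elim exE conjE bexE)
  fix a b c d A B
  assume h: "a < b" "b < c" "c < d" "A \<in> complement n P" "B \<in> complement n P" "A \<noteq> B"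
    "a \<in> A" "c \<in> A" "b \<in> B" "d \<in> B"
  then obtain A' B' where AB: "A' \<in> P" "A = reflect n ` A'" "B' \<in> P" "B = reflect n ` B'"
    unfolding complement_eq_reflect by blast
  have "A' \<subseteq> {1..n}" "B' \<subseteq> {1..n}" using AB assms(1) by (auto simp: partition_on_def)
  then have sub: "reflect n a \<in> A'" "reflect n c \<in> A'" "reflect n b \<in> B'" "reflect n d \<in> B'"
    "d \<le> n"
    using h(7-10) unfolding AB(2,4) by (simp_all add: reflect_image_mem)
  \<comment> \<open>The bound \<open>d \<le> n\<close> keeps the subtraction in
    \<open>reflect\<close> from truncating, so the order reverses strictly.\<close>
  moreover have "reflect n d < reflect n c" "reflect n c < reflect n b" "reflect n b < reflect n a"
    using h \<open>d \<le> n\<close> by (auto simp: reflect_def)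
  ultimately have "B' = A'" using noncrossingD[OF assms(2)] AB by blast
  then show False using AB h by simp
qed

lemma Min_Max_complement:
  assumes "partition_on {1..n} P"
  shows "Min ` complement n P = reflect n ` Max ` P" "Max ` complement n P = reflect n ` Min ` P"
proof -
  have "Min (reflect n ` B) = reflect n (Max B) \<and> Max (reflect n ` B) = reflect n (Min B)"
    if "B \<in> P" for B
  proof -
    note blk = partition_on_finite_block[OF finite_atLeastAtMost assms that]
    show ?thesis
      using blk by (intro conjI Min_eqI Max_eqI) (auto simp: reflect_def intro!: diff_le_mono2)
  qed
  then show "Min ` complement n P = reflect n ` Max ` P" "Max ` complement n P = reflect n ` Min ` P"
    unfolding complement_eq_reflect image_image by (auto intro!: image_cong)
qed

text \<open>Reflection is an involution on \<open>{1..n}\<close>, so the one equation makes both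
  minima and maxima of the complement agree with those of \<open>P\<close>; uniqueness then gives
  equality.\<close>

lemma self_complementary_iff:
  assumes "partition_on {1..n} P" "noncrossing P"
  shows "self_complementary n P \<longleftrightarrow> Max ` P = reflect n ` Min ` P"
proof
  assume "self_complementary n P"
  then show "Max ` P = reflect n ` Min ` P"
    using Min_Max_complement(2)[OF assms(1)] by (simp add: self_complementary_def)
next
  assume eq: "Max ` P = reflect n ` Min ` P"
  have "reflect n ` reflect n ` Min ` P = Min ` P"
    using partition_on_finite_block(3,5)[OF finite_atLeastAtMost assms(1)]
    by (intro reflect_image_image) blast
  then have "Min ` complement n P = Min ` P" "Max ` complement n P = Max ` P"
    using Min_Max_complement[OF assms(1)] eq by simp_all
  then have "complement n P = P"
    using assms partition_on_complement noncrossing_complement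
    by (intro noncrossing_eqI[OF finite_atLeastAtMost])
  then show "self_complementary n P" by (simp add: self_complementary_def)
qed

text \<open>The maxima before the element \<open>Suc i\<close> are the mirror images of the members
  of \<open>M\<close> among the last \<open>i\<close> elements. The index shifts from
  \<open>{1..n}\<close> to \<open>i < n\<close>.\<close>

lemma admissible_reflect_iff:
  "admissible {1..n} M (reflect n ` M) \<longleftrightarrow> M \<in> ballot_sets 1 n 0"
proof (cases "M \<subseteq> {1..n}")
  case True
  have inj: "inj_on (reflect n) B" if "B \<subseteq> {1..n}" for B
    using bij_betw_reflect that by (metis bij_betw_def inj_on_subset)
  have "card (reflect n ` M \<inter> {..<Suc i}) = card (M \<inter> {1 + n - i..<1 + n})" if "i < n" for i
  proof -
    have "reflect n ` M \<inter> {..<Suc i} = reflect n ` (M \<inter> {1 + n - i..<1 + n})"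
      using True that by (fastforce simp: reflect_def)
    moreover have "inj_on (reflect n) (M \<inter> {1 + n - i..<1 + n})" using True by (intro inj) auto
    ultimately show ?thesis by (simp add: card_image)
  qed
  moreover have "M \<inter> {..Suc i} = M \<inter> {1..1 + i}" for i using True by auto
  moreover have "reflect n ` M \<subseteq> {1..n}" using True bij_betw_reflect[of n] by (auto simp: bij_betw_def)
  moreover have "card (reflect n ` M) = card M" using inj True by (simp add: card_image)
  moreover have "(\<forall>i\<in>{1..n}. Q i) \<longleftrightarrow> (\<forall>i<n. Q (Suc i))" for Q
    by (metis One_nat_def atLeastAtMost_iff Suc_le_eq not0_implies_Suc not_less0 zero_less_Suc)
  ultimately show ?thesis using True
    by (simp add: admissible_def ballot_sets_def atLeastLessThanSuc_atLeastAtMost)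
next
  case False
  then show ?thesis by (auto simp: admissible_def ballot_sets_def)
qed

section \<open>The bijection with ballot sets\<close>

theorem theorem1:
  fixes n :: nat
  assumes "n \<ge> 1"
  shows "card {P. partition_on {1..n} P \<and> noncrossing P \<and> self_complementary n P}
           = n choose (n div 2)"
proof -
  let ?S = "{P. partition_on {1..n} P \<and> noncrossing P \<and> self_complementary n P}"
  \<comment> \<open>The minima suffice, since self-complementarity fixes the maxima as their
    reflection.\<close>
  have "bij_betw ((`) Min) ?S (ballot_sets 1 n 0)"
    unfolding bij_betw_def
  proof
    show "inj_on ((`) Min) ?S"
    proof (rule inj_onI)
      fix P Q assume PQ: "P \<in> ?S" "Q \<in> ?S" "Min ` P = Min ` Q"
      have "Max ` P = reflect n ` Min ` P" "Max ` Q = reflect n ` Min ` Q"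
        using PQ(1,2) self_complementary_iff by blast+
      then have "Max ` P = Max ` Q" using PQ(3) by simp
      then show "P = Q"
        using PQ by (intro noncrossing_eqI[of "{1..n}"]) auto
    qed
    show "(`) Min ` ?S = ballot_sets 1 n 0"
    proof (intro set_eqI iffI)
      fix M assume "M \<in> (`) Min ` ?S"
      then obtain P where P: "P \<in> ?S" "M = Min ` P" by blast
      then have "Max ` P = reflect n ` M" using self_complementary_iff by blast
      then have "admissible {1..n} M (reflect n ` M)"
        using admissible_Min_Max[of "{1..n}" P] P by simp
      then show "M \<in> ballot_sets 1 n 0" by (simp only: admissible_reflect_iff)
    next
      fix M assume "M \<in> ballot_sets 1 n 0"
      then have "admissible {1..n} M (reflect n ` M)" by (simp only: admissible_reflect_iff)
      then obtain P where P: "partition_on {1..n} P" "noncrossing P" "Min ` P = M"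
          "Max ` P = reflect n ` M"
        using ex1_implies_ex[OF ex1_noncrossing[OF finite_atLeastAtMost]] by blast
      then have "P \<in> ?S" using self_complementary_iff by simp
      then show "M \<in> (`) Min ` ?S" using P(3) by blast
    qed
  qed
  then have "card ?S = card (ballot_sets 1 n 0)" by (rule bij_betw_same_card)
  \<comment> \<open>At \<open>h = 0\<close> the sum over \<open>d\<close> is empty and only the
    central coefficient remains.\<close>
  then show ?thesis by (simp add: card_ballot_sets central_sum_def)
qed

end
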